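(* Let $E$ be a Banach space, and let $D,Q\ge 1$ be constants. For each $n\in\mathbb{N}$ let $\Gamma_n$ be a group with a finite symmetric generating set $S_n$, let $\rho_n\colon\Gamma_n\curvearrowright(X_n,\nu_n)$ be a measure preserving action on a probability space, and let $\mathcal{P}_n$ be a partition of $X_n$ into finitely many measurable sets. Assume that all the partitions $\mathcal{P}_n$ have $Q$-bounded measure ratios and that all the approximating graphs $\mathcal{G}_{\mathcal{P}_n}(\Gamma_n\curvearrowright X_n)$ have degree at most $D$. If the actions $\rho_n$ all have $E$-spectral gap with a uniform constant $\varepsilon>0$, then the approximating graphs $\mathcal{G}_{\mathcal{P}_n}(\Gamma_n\curvearrowright X_n)$ do not coarsely embed into $E$ uniformly.
   Context: Approximating graph: given a measure preserving action of a group $\Gamma$ with finite symmetric generating set $S$ on a probability space $(X,\nu)$ and a partition $\mathcal{P}$ of $X$ into finitely many disjoint measurable sets (regions), $\mathcal{G}_{\mathcal{P}}(\Gamma\curvearrowright X)$ is the graph with vertex set $\mathcal{P}$ in which $R,R'\in\mathcal{P}$ are joined by an edge if there is $s\in S$ with $\nu((s\cdot R)\cap R')>0$. By convention a (connected) graph is viewed as a metric space on its vertex set with the shortest path distance. The degree of a graph is the maximum of the degrees of its vertices. The partition $\mathcal{P}$ has $Q$-bounded measure ratios if $\nu(R)/\nu(R')\le Q$ for all $R,R'\in\mathcal{P}$. Spectral gap: let $L^2(X,\nu;E)$ be the Bochner space of square-integrable functions $f\colon X\to E$ with norm $\|f\|_B=(\int_X\|f(x)\|_E^2\,d\nu(x))^{1/2}$,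 with $\Gamma$ acting by $(\gamma\cdot f)(x)=f(\gamma^{-1}\cdot x)$, and let $L^2_0(X,\nu;E)$ be the subspace of functions with zero mean. The action has $E$-spectral gap with constant $\varepsilon>0$ if $\max_{s\in S}\|f-s\cdot f\|_B\ge\varepsilon\|f\|_B$ for every $f\in L^2_0(X,\nu;E)$. Uniform coarse embedding: a sequence of metric spaces $(Y_n)$ coarsely embeds into $E$ uniformly if there are increasing unbounded functions $\rho_-,\rho_+\colon[0,\infty)\to[0,\infty)$ and maps $f_n\colon Y_n\to E$ with $\rho_-(d(y_1,y_2))\le\|f_n(y_1)-f_n(y_2)\|_E\le\rho_+(d(y_1,y_2))$ for all $n$ and all $y_1,y_2\in Y_n$.
   Formalization: Adds the assumption that the numbers of regions |P_n| are unbounded; without it the claim is false (trivial groups acting on one-point spaces give one-vertex graphs, which embed uniformly). *)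

theory Defs
  imports
    "HOL-Probability.Probability"
    "HOL-Algebra.Group_Action"
    "HOL-Algebra.Generated_Groups"
begin

section \<open>Measure preserving actions\<close>

definition measure_preserving_action ::
    "('g, 'b) monoid_scheme \<Rightarrow> 'x measure \<Rightarrow> ('g \<Rightarrow> 'x \<Rightarrow> 'x) \<Rightarrow> bool" where
  "measure_preserving_action \<Gamma> M \<phi> \<longleftrightarrow>
     group_action \<Gamma> (space M) \<phi> \<and>
     (\<forall>g\<in>carrier \<Gamma>. \<phi> g \<in> measurable M M \<and> distr M M (\<phi> g) = M)"

definition finite_symmetric_generating_set ::
    "('g, 'b) monoid_scheme \<Rightarrow> 'g set \<Rightarrow> bool" where
  "finite_symmetric_generating_set \<Gamma> S \<longleftrightarrow>
     finite S \<and> S \<subseteq> carrier \<Gamma> \<and> (\<forall>s\<in>S. inv\<^bsub>\<Gamma>\<^esub> s \<in> S) \<and> generate \<Gamma> S = carrier \<Gamma>"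

definition finite_measurable_partition :: "'x measure \<Rightarrow> 'x set set \<Rightarrow> bool" where
  "finite_measurable_partition M \<P> \<longleftrightarrow>
     finite \<P> \<and> \<P> \<subseteq> sets M \<and> partition_on (space M) \<P>"

text \<open>The ratios only make sense for regions of positive measure; this has to be said explicitly
  because division by zero yields zero.\<close>

definition bounded_measure_ratios :: "'x measure \<Rightarrow> 'x set set \<Rightarrow> real \<Rightarrow> bool" where
  "bounded_measure_ratios M \<P> Q \<longleftrightarrow>
     (\<forall>R\<in>\<P>. measure M R > 0) \<and> (\<forall>R\<in>\<P>. \<forall>R'\<in>\<P>. measure M R / measure M R' \<le> Q)"


section \<open>Graphs and their path metric\<close>

text \<open>A simple graph is given by its vertex set and by the relation of being joined by an edge.\<close>

definition graph_degree :: "'v set \<Rightarrow> ('v \<times> 'v) set \<Rightarrow> nat" where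
  "graph_degree V E = Max ((\<lambda>v. card (E `` {v})) ` V)"

text \<open>Vertices that are not joined by any path get the dummy distance 0.  For distinct vertices this
  violates the metric axioms, so a disconnected graph is not a metric space.\<close>

definition graph_dist :: "('v \<times> 'v) set \<Rightarrow> 'v \<Rightarrow> 'v \<Rightarrow> real" where
  "graph_dist E u v = (if (u, v) \<in> E\<^sup>* then real (LEAST k. (u, v) \<in> E ^^ k) else 0)"

lemma Metric_space_graph_dist:
  assumes "sym E"
  shows "Metric_space V (graph_dist E) \<longleftrightarrow> V \<times> V \<subseteq> E\<^sup>*"
proof
  assume M: "Metric_space V (graph_dist E)"
  show "V \<times> V \<subseteq> E\<^sup>*"
  proof clarify
    fix u v assume "u \<in> V" "v \<in> V"
    then have "graph_dist E u v = 0 \<longleftrightarrow> u = v"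
      using M by (simp add: Metric_space_def)
    then show "(u, v) \<in> E\<^sup>*"
      by (auto simp: graph_dist_def split: if_splits)
  qed
next
  assume conn: "V \<times> V \<subseteq> E\<^sup>*"
  have flip: "(v, u) \<in> E ^^ k" if "(u, v) \<in> E ^^ k" for u v k
    using that
  proof (induction k arbitrary: v)
    case (Suc k)
    then obtain w where "(u, w) \<in> E ^^ k" "(w, v) \<in> E" by auto
    then have "(v, w) \<in> E" "(w, u) \<in> E ^^ k"
      using Suc.IH assms by (auto dest: symD)
    then show ?case by (rule relpow_Suc_I2)
  qed auto
  have attained: "(u, v) \<in> E ^^ (LEAST k. (u, v) \<in> E ^^ k)" if "(u, v) \<in> E\<^sup>*" for u v
    using that by (metis LeastI rtrancl_imp_relpow)
  show "Metric_space V (graph_dist E)"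
  proof
    fix u v show "0 \<le> graph_dist E u v" by (simp add: graph_dist_def)
  next
    fix u v
    have "(u, v) \<in> E ^^ k \<longleftrightarrow> (v, u) \<in> E ^^ k" for k using flip by blast
    then show "graph_dist E u v = graph_dist E v u"
      by (simp add: graph_dist_def rtrancl_power)
  next
    fix u v assume uv: "u \<in> V" "v \<in> V"
    show "graph_dist E u v = 0 \<longleftrightarrow> u = v"
    proof
      assume "graph_dist E u v = 0"
      moreover have "(u, v) \<in> E\<^sup>*" using conn uv by blast
      ultimately have "(LEAST k. (u, v) \<in> E ^^ k) = 0" by (simp add: graph_dist_def)
      then show "u = v" using attained[OF \<open>(u, v) \<in> E\<^sup>*\<close>] by simp
    next
      assume "u = v"
      then have "(LEAST k. (u, v) \<in> E ^^ k) = 0" by (intro Least_equality) auto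
      then show "graph_dist E u v = 0" by (simp add: graph_dist_def)
    qed
  next
    fix u v w assume "u \<in> V" "v \<in> V" "w \<in> V"
    then have r: "(u, v) \<in> E\<^sup>*" "(v, w) \<in> E\<^sup>*" "(u, w) \<in> E\<^sup>*" using conn by blast+
    have "(u, w) \<in> E ^^ ((LEAST k. (u, v) \<in> E ^^ k) + (LEAST k. (v, w) \<in> E ^^ k))"
      using attained[OF r(1)] attained[OF r(2)] by (auto simp: relpow_add)
    then have "(LEAST k. (u, w) \<in> E ^^ k)
        \<le> (LEAST k. (u, v) \<in> E ^^ k) + (LEAST k. (v, w) \<in> E ^^ k)"
      by (rule Least_le)
    then show "graph_dist E u w \<le> graph_dist E u v + graph_dist E v w"
      using r by (simp add: graph_dist_def)
  qed
qed


section \<open>Approximating graphs\<close>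

text \<open>The edges of the approximating graph with vertex set \<^term>\<open>\<P>\<close>.  Loops are discarded, which does
  not affect distances and can only decrease the degree.\<close>

definition approximating_graph ::
    "'g set \<Rightarrow> 'x measure \<Rightarrow> ('g \<Rightarrow> 'x \<Rightarrow> 'x) \<Rightarrow> 'x set set \<Rightarrow> ('x set \<times> 'x set) set" where
  "approximating_graph S M \<phi> \<P> =
     {(R, R'). R \<in> \<P> \<and> R' \<in> \<P> \<and> R \<noteq> R' \<and> (\<exists>s\<in>S. measure M (\<phi> s ` R \<inter> R') > 0)}"

lemma sym_approximating_graph:
  assumes act: "measure_preserving_action \<Gamma> M \<phi>"
    and S: "finite_symmetric_generating_set \<Gamma> S"
    and P: "\<P> \<subseteq> sets M"
  shows "sym (approximating_graph S M \<phi> \<P>)"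
proof (rule symI)
  fix R R' assume "(R, R') \<in> approximating_graph S M \<phi> \<P>"
  then obtain s where R: "R \<in> \<P>" "R' \<in> \<P>" "R \<noteq> R'"
    and s: "s \<in> S" "measure M (\<phi> s ` R \<inter> R') > 0"
    by (auto simp: approximating_graph_def)
  interpret group_action \<Gamma> "space M" \<phi>
    using act by (simp add: measure_preserving_action_def)
  interpret G: group \<Gamma> using group_hom by (simp add: group_hom_def)
  let ?t = "inv\<^bsub>\<Gamma>\<^esub> s"
  have sc: "s \<in> carrier \<Gamma>" and t: "?t \<in> S" "?t \<in> carrier \<Gamma>"
    using S s(1) by (auto simp: finite_symmetric_generating_set_def)
  have sub: "R \<subseteq> space M" "R' \<subseteq> space M"
    using R P sets.sets_into_space by blast+
  have inv1: "\<phi> ?t (\<phi> s x) = x" and inv2: "\<phi> s (\<phi> ?t x) = x" if "x \<in> space M" for x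
    using orbit_sym_aux[OF sc that refl] orbit_sym_aux[OF t(2) that refl] sc by auto
  have into: "\<phi> g x \<in> space M" if "g \<in> carrier \<Gamma>" "x \<in> space M" for g x
    using element_image[OF that refl] .
  have mp: "\<phi> s \<in> measurable M M" "distr M M (\<phi> s) = M" "\<phi> ?t \<in> measurable M M"
    using act sc t by (auto simp: measure_preserving_action_def)
  have im: "\<phi> s ` R = \<phi> ?t -` R \<inter> space M"
  proof (intro equalityI subsetI)
    fix y assume "y \<in> \<phi> s ` R"
    then show "y \<in> \<phi> ?t -` R \<inter> space M" using sub into sc inv1 by fastforce
  next
    fix y assume "y \<in> \<phi> ?t -` R \<inter> space M"
    then show "y \<in> \<phi> s ` R" using inv2[of y] by (auto intro!: image_eqI[of y "\<phi> s" "\<phi> ?t y"])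
  qed
  have meas: "\<phi> s ` R \<inter> R' \<in> sets M"
    unfolding im using R P mp(3) by (intro sets.Int measurable_sets) auto
  have "\<phi> s -` (\<phi> s ` R \<inter> R') \<inter> space M = \<phi> ?t ` R' \<inter> R"
  proof (intro equalityI subsetI)
    fix x assume "x \<in> \<phi> s -` (\<phi> s ` R \<inter> R') \<inter> space M"
    then obtain y where x: "x \<in> space M" "\<phi> s x \<in> R'" "y \<in> R" "\<phi> s x = \<phi> s y" by auto
    have "x = y" using x inv1 sub by (metis subsetD)
    moreover have "x \<in> \<phi> ?t ` R'"
      using inv1[OF x(1)] x(2) by (rule image_eqI[OF sym])
    ultimately show "x \<in> \<phi> ?t ` R' \<inter> R" using x(3) by blast
  next
    fix x assume "x \<in> \<phi> ?t ` R' \<inter> R"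
    then show "x \<in> \<phi> s -` (\<phi> s ` R \<inter> R') \<inter> space M" using sub inv2 by auto
  qed
  then have "measure M (\<phi> ?t ` R' \<inter> R) = measure M (\<phi> s ` R \<inter> R')"
    using measure_distr[OF mp(1) meas] mp(2) by simp
  then have "measure M (\<phi> ?t ` R' \<inter> R) > 0"
    using s(2) by simp
  then have "\<exists>s\<in>S. measure M (\<phi> s ` R' \<inter> R) > 0"
    using t(1) by blast
  then show "(R', R) \<in> approximating_graph S M \<phi> \<P>"
    using R by (simp add: approximating_graph_def)
qed


section \<open>Bochner spaces and spectral gap\<close>

text \<open>The Bochner integral of the library is confined to separable target spaces.  The following
  definitions apply to arbitrary Banach spaces; the second one is the definition of
  \<^const>\<open>has_bochner_integral\<close> with Borel measurability replaced by strong measurability.\<close>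

definition strongly_measurable :: "'x measure \<Rightarrow> ('x \<Rightarrow> 'e::banach) \<Rightarrow> bool" where
  "strongly_measurable M f \<longleftrightarrow>
     (\<exists>s. (\<forall>i. simple_function M (s i)) \<and> (\<forall>x\<in>space M. (\<lambda>i. s i x) \<longlonglongrightarrow> f x))"

definition has_strong_integral :: "'x measure \<Rightarrow> ('x \<Rightarrow> 'e::banach) \<Rightarrow> 'e \<Rightarrow> bool" where
  "has_strong_integral M f v \<longleftrightarrow>
     strongly_measurable M f \<and>
     (\<exists>s. (\<forall>i. Bochner_Integration.simple_bochner_integrable M (s i)) \<and>
          (\<lambda>i. \<integral>\<^sup>+x. norm (f x - s i x) \<partial>M) \<longlonglongrightarrow> 0 \<and>
          (\<lambda>i. Bochner_Integration.simple_bochner_integral M (s i)) \<longlonglongrightarrow> v)"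

definition bochner_L2 :: "'x measure \<Rightarrow> ('x \<Rightarrow> 'e::banach) set" where
  "bochner_L2 M = {f. strongly_measurable M f \<and> integrable M (\<lambda>x. (norm (f x))\<^sup>2)}"

definition bochner_norm :: "'x measure \<Rightarrow> ('x \<Rightarrow> 'e::banach) \<Rightarrow> real" where
  "bochner_norm M f = sqrt (\<integral>x. (norm (f x))\<^sup>2 \<partial>M)"

definition bochner_L2_0 :: "'x measure \<Rightarrow> ('x \<Rightarrow> 'e::banach) set" where
  "bochner_L2_0 M = {f \<in> bochner_L2 M. has_strong_integral M f 0}"

definition translate ::
    "('g, 'b) monoid_scheme \<Rightarrow> ('g \<Rightarrow> 'x \<Rightarrow> 'x) \<Rightarrow> 'g \<Rightarrow> ('x \<Rightarrow> 'e) \<Rightarrow> 'x \<Rightarrow> 'e" where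
  "translate \<Gamma> \<phi> g f = (\<lambda>x. f (\<phi> (inv\<^bsub>\<Gamma>\<^esub> g) x))"

text \<open>Inserting 0 sets the maximum over an empty generating set of the trivial group to 0; it changes
  nothing for nonempty \<^term>\<open>S\<close> because norms are nonnegative.\<close>

definition spectral_gap ::
    "'e::banach itself \<Rightarrow> ('g, 'b) monoid_scheme \<Rightarrow> 'g set \<Rightarrow> 'x measure \<Rightarrow>
     ('g \<Rightarrow> 'x \<Rightarrow> 'x) \<Rightarrow> real \<Rightarrow> bool" where
  "spectral_gap _ \<Gamma> S M \<phi> \<epsilon> \<longleftrightarrow>
     (\<forall>f \<in> (bochner_L2_0 M :: ('x \<Rightarrow> 'e) set).
        Max (insert 0 ((\<lambda>s. bochner_norm M (\<lambda>x. f x - translate \<Gamma> \<phi> s f x)) ` S))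
          \<ge> \<epsilon> * bochner_norm M f)"


section \<open>Uniform coarse embeddings\<close>

definition coarsely_embed_uniformly ::
    "'e::banach itself \<Rightarrow> (nat \<Rightarrow> 'v set) \<Rightarrow> (nat \<Rightarrow> 'v \<Rightarrow> 'v \<Rightarrow> real) \<Rightarrow> bool" where
  "coarsely_embed_uniformly _ Y d \<longleftrightarrow>
     (\<forall>n. Metric_space (Y n) (d n)) \<and>
     (\<exists>(\<rho>\<^sub>1 :: real \<Rightarrow> real) (\<rho>\<^sub>2 :: real \<Rightarrow> real) (f :: nat \<Rightarrow> 'v \<Rightarrow> 'e).
        \<rho>\<^sub>1 \<in> {0..} \<rightarrow> {0..} \<and> mono_on {0..} \<rho>\<^sub>1 \<and> \<not> bdd_above (\<rho>\<^sub>1 ` {0..}) \<and>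
        \<rho>\<^sub>2 \<in> {0..} \<rightarrow> {0..} \<and> mono_on {0..} \<rho>\<^sub>2 \<and> \<not> bdd_above (\<rho>\<^sub>2 ` {0..}) \<and>
        (\<forall>n. \<forall>y\<in>Y n. \<forall>y'\<in>Y n.
           \<rho>\<^sub>1 (d n y y') \<le> norm (f n y - f n y') \<and> norm (f n y - f n y') \<le> \<rho>\<^sub>2 (d n y y')))"

end

theory Submission
  imports Defs
begin

text \<open>A uniform coarse embedding of the vertices, shifted by its mean, gives a step function in
  \<open>L\<^sup>2\<^sub>0\<close>.  Generators move almost every point to the same or to an adjacent region, so they change
  this function by at most a constant, and the spectral gap bounds its norm independently of \<open>n\<close>.
  By Markov's inequality and the bounded measure ratios, a fixed proportion of the vertices has
  image in a ball of fixed radius, hence lies in a graph ball of fixed radius; the degree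
  bound then bounds the number of vertices.\<close>

section \<open>Step functions on a finite partition\<close>

text \<open>A map \<open>f\<close> on the regions becomes the step function
  \<open>\<lambda>x. f (block P x)\<close> on the space. The value of \<open>block P\<close> is
  unspecified off the union of \<open>P\<close>, so the lemmas below concern points covered by the
  partition.\<close>

definition block :: "'x set set \<Rightarrow> 'x \<Rightarrow> 'x set" where
  "block P x = (THE R. R \<in> P \<and> x \<in> R)"

lemma block_eq:
  assumes "partition_on A P" "R \<in> P" "x \<in> R"
  shows "block P x = R"
  unfolding block_def using assms
  by (intro the_equality) (auto simp: partition_on_def disjoint_def)

lemma block_in:
  assumes "partition_on A P" "x \<in> A"
  shows "block P x \<in> P" "x \<in> block P x"
proof -
  obtain R where "R \<in> P" "x \<in> R"
    using assms by (auto simp: partition_on_def)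
  then show "block P x \<in> P" "x \<in> block P x"
    using block_eq[OF assms(1)] by auto
qed

lemma block_fibre:
  assumes "partition_on A P" "R \<in> P"
  shows "{x \<in> A. block P x = R} = R"
  using assms block_in[OF assms(1)] block_eq[OF assms] by (auto simp: partition_on_def)

lemma block_image:
  assumes "partition_on A P"
  shows "block P ` A = P"
proof
  show "block P ` A \<subseteq> P"
    using block_in[OF assms] by auto
  show "P \<subseteq> block P ` A"
  proof
    fix R assume "R \<in> P"
    then have "R \<noteq> {}" "R \<subseteq> A"
      using assms by (auto simp: partition_on_def)
    then show "R \<in> block P ` A"
      using block_eq[OF assms \<open>R \<in> P\<close>] by (metis ex_in_conv image_eqI subsetD)
  qed
qed

lemma simple_function_block:
  assumes "finite_measurable_partition M P"
  shows "simple_function M (block P)"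
proof -
  have P: "finite P" "P \<subseteq> sets M" "partition_on (space M) P"
    using assms by (auto simp: finite_measurable_partition_def)
  have "block P -` {R} \<inter> space M = R" if "R \<in> P" for R
    using block_fibre[OF P(3) that] by auto
  then show ?thesis
    using P by (auto simp: simple_function_def block_image[OF P(3)])
qed

section \<open>Step functions in the Bochner space\<close>

lemma (in finite_measure) step_function_integrable:
  assumes "simple_function M F"
  shows "Bochner_Integration.simple_bochner_integrable M F"
  using assms by (intro Bochner_Integration.simple_bochner_integrable.intros) auto

lemma (in finite_measure) simple_function_bochner_L2:
  assumes "simple_function M F"
  shows "F \<in> bochner_L2 M"
proof -
  have "strongly_measurable M F"
    unfolding strongly_measurable_def using assms by (intro exI[of _ "\<lambda>_. F"]) auto
  moreover have "integrable M (\<lambda>x. (norm (F x))\<^sup>2)"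
    using simple_function_compose1[OF assms, of "\<lambda>y. (norm y)\<^sup>2"]
    by (intro integrable_simple_function) auto
  ultimately show ?thesis
    by (simp add: bochner_L2_def)
qed

lemma (in finite_measure) simple_function_has_strong_integral:
  assumes "simple_function M F"
  shows "has_strong_integral M F (Bochner_Integration.simple_bochner_integral M F)"
proof -
  have "strongly_measurable M F"
    using simple_function_bochner_L2[OF assms] by (simp add: bochner_L2_def)
  then show ?thesis
    unfolding has_strong_integral_def using step_function_integrable[OF assms]
    by (intro conjI exI[of _ "\<lambda>_. F"]) auto
qed

lemma (in prob_space) sum_prob_partition:
  assumes "finite_measurable_partition M P"
  shows "(\<Sum>R\<in>P. prob R) = 1"
proof -
  have "finite P" "P \<subseteq> events" "disjoint_family_on (\<lambda>R. R) P" "(\<Union>R\<in>P. R) = space M"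
    using assms by (auto simp: finite_measurable_partition_def partition_on_def
        disjoint_family_on_def disjoint_def)
  then show ?thesis
    using finite_measure_finite_Union[of P "\<lambda>R. R"] prob_space by simp
qed

text \<open>The subtracted constant is the mean of the step function; since the regions have total
  mass 1, the difference has integral 0.\<close>

lemma (in prob_space) centred_step_function_L2_0:
  fixes f :: "'a set \<Rightarrow> 'e::banach"
  assumes P: "finite_measurable_partition M P"
  shows "(\<lambda>x. f (block P x) - (\<Sum>R\<in>P. prob R *\<^sub>R f R)) \<in> bochner_L2_0 M"
proof -
  let ?c = "\<Sum>R\<in>P. prob R *\<^sub>R f R"
  let ?F = "\<lambda>x. f (block P x) - ?c"
  have part: "finite P" "P \<subseteq> sets M" "partition_on (space M) P"
    using P by (auto simp: finite_measurable_partition_def)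
  have F: "simple_function M ?F"
    using simple_function_compose1[OF simple_function_block[OF P], of "\<lambda>R. f R - ?c"] .
  have mean: "(\<Sum>R\<in>P. prob R *\<^sub>R (f R - ?c)) = 0"
    using sum_prob_partition[OF P] by (simp add: scaleR_diff_right sum_subtractf flip: scaleR_sum_left)
  have "Bochner_Integration.simple_bochner_integral M ?F =
      (\<Sum>R\<in>block P ` space M. prob {x \<in> space M. block P x = R} *\<^sub>R (f R - ?c))"
    \<comment> \<open>The sum runs over regions rather than over values of \<open>?F\<close>, since
      \<open>f\<close> may agree on several regions. It suffices that \<open>?F\<close> factors
      through \<open>block P\<close>.\<close>
    by (rule Bochner_Integration.simple_bochner_integral_partition
        [OF step_function_integrable[OF F] simple_function_block[OF P]]) auto
  also have "\<dots> = 0"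
    using mean by (simp add: block_image[OF part(3)] block_fibre[OF part(3)] cong: sum.cong)
  finally show ?thesis
    using simple_function_bochner_L2[OF F] simple_function_has_strong_integral[OF F]
    by (simp add: bochner_L2_0_def)
qed

section \<open>Translation by generators and the spectral gap\<close>

text \<open>If \<open>y x\<close> lies in \<open>R\<close> and \<open>x\<close> in
  \<open>R'\<close>, then \<open>x\<close> lies in \<open>\<phi> s\<close> applied to
  \<open>R\<close>, intersected with \<open>R'\<close>. There are finitely many pairs of regions, so
  the intersections of measure zero can be discarded together; any other pair is an edge or has
  \<open>R = R'\<close>, a case kept separate because the graph has no loops.\<close>

lemma AE_translate_adjacent:
  assumes prob: "prob_space M"
    and act: "measure_preserving_action \<Gamma> M \<phi>"
    and S: "finite_symmetric_generating_set \<Gamma> S"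
    and P: "finite_measurable_partition M P"
    and s: "s \<in> S"
  defines "y \<equiv> \<lambda>x. \<phi> (inv\<^bsub>\<Gamma>\<^esub> s) x"
  shows "AE x in M. block P (y x) = block P x \<or>
           (block P (y x), block P x) \<in> approximating_graph S M \<phi> P"
proof -
  interpret prob_space M by fact
  interpret group_action \<Gamma> "space M" \<phi>
    using act by (simp add: measure_preserving_action_def)
  interpret G: group \<Gamma> using group_hom by (simp add: group_hom_def)
  have part: "finite P" "P \<subseteq> sets M" "partition_on (space M) P"
    using P by (auto simp: finite_measurable_partition_def)
  have sc: "s \<in> carrier \<Gamma>" "inv\<^bsub>\<Gamma>\<^esub> s \<in> carrier \<Gamma>"
    using S s by (auto simp: finite_symmetric_generating_set_def)
  have y: "y \<in> measurable M M"
    using act sc(2) by (simp add: y_def measure_preserving_action_def)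
  have inv1: "y (\<phi> s x) = x" and inv2: "\<phi> s (y x) = x" if "x \<in> space M" for x
    using orbit_sym_aux[OF sc(1) that refl] orbit_sym_aux[OF sc(2) that refl] sc
    by (auto simp: y_def)
  \<comment> \<open>Rewriting the image as a preimage under the inverse makes it measurable.\<close>
  have im: "\<phi> s ` R = y -` R \<inter> space M" if "R \<in> P" for R
  proof -
    have "R \<subseteq> space M"
      using that part sets.sets_into_space by blast
    then show ?thesis
      using inv1 inv2 element_image[OF sc(1) _ refl] by (force simp: image_iff)
  qed
  have meas: "\<phi> s ` R \<inter> R' \<in> events" if "R \<in> P" "R' \<in> P" for R R'
    unfolding im[OF that(1)] using that part y by (intro sets.Int measurable_sets) auto
  have "AE x in M. \<forall>R\<in>P. \<forall>R'\<in>P. prob (\<phi> s ` R \<inter> R') = 0 \<longrightarrow> x \<notin> \<phi> s ` R \<inter> R'"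
  proof (intro AE_finite_allI part(1))
    fix R R' assume RR: "R \<in> P" "R' \<in> P"
    show "AE x in M. prob (\<phi> s ` R \<inter> R') = 0 \<longrightarrow> x \<notin> \<phi> s ` R \<inter> R'"
    proof (cases "prob (\<phi> s ` R \<inter> R') = 0")
      case True
      then have "\<phi> s ` R \<inter> R' \<in> null_sets M"
        using meas[OF RR] by (simp add: null_sets_def emeasure_eq_measure)
      from AE_not_in[OF this] show ?thesis by auto
    qed auto
  qed
  then show ?thesis
  proof (rule AE_mp[OF _ AE_I2], intro impI)
    fix x assume x: "x \<in> space M"
      and *: "\<forall>R\<in>P. \<forall>R'\<in>P. prob (\<phi> s ` R \<inter> R') = 0 \<longrightarrow> x \<notin> \<phi> s ` R \<inter> R'"
    have yx: "y x \<in> space M" using y x by (rule measurable_space)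
    note b = block_in[OF part(3) yx] block_in[OF part(3) x]
    have "x \<in> \<phi> s ` block P (y x) \<inter> block P x"
      using b x by (auto simp: im)
    then have "prob (\<phi> s ` block P (y x) \<inter> block P x) > 0"
      using * b by (metis zero_less_measure_iff)
    then show "block P (y x) = block P x \<or>
        (block P (y x), block P x) \<in> approximating_graph S M \<phi> P"
      using b s by (auto simp: approximating_graph_def)
  qed
qed

lemma (in prob_space) bochner_norm_le_const:
  assumes "AE x in M. norm (f x) \<le> L" "0 \<le> L"
  shows "bochner_norm M f \<le> L"
proof -
  have "expectation (\<lambda>x. (norm (f x))\<^sup>2) \<le> L\<^sup>2"
  \<comment> \<open>A function that is not integrable has integral 0 by convention, so the bound
    also holds then, and integrability of translates never has to be checked.\<close>
  proof (cases "integrable M (\<lambda>x. (norm (f x))\<^sup>2)")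
    case True
    then show ?thesis
      using assms(1) by (intro integral_le_const) (auto elim!: eventually_mono intro: power_mono)
  qed (simp add: not_integrable_integral_eq)
  then show ?thesis
    using assms(2) unfolding bochner_norm_def by (intro real_le_lsqrt) auto
qed

text \<open>The mean cancels in the difference of the centred step function and its translate.
  Almost everywhere this difference compares \<open>f\<close> on equal or adjacent regions, so each
  displacement in the spectral gap inequality is at most \<open>L\<close>.\<close>

lemma spectral_gap_step_function_norm:
  fixes f :: "'x set \<Rightarrow> 'e::banach"
  assumes prob: "prob_space M"
    and act: "measure_preserving_action \<Gamma> M \<phi>"
    and S: "finite_symmetric_generating_set \<Gamma> S"
    and P: "finite_measurable_partition M P"
    and gap: "spectral_gap TYPE('e) \<Gamma> S M \<phi> \<epsilon>"
    and lip: "\<And>R R'. (R, R') \<in> approximating_graph S M \<phi> P \<Longrightarrow> norm (f R - f R') \<le> L"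
    and L: "0 \<le> L"
  shows "\<epsilon> * bochner_norm M (\<lambda>x. f (block P x) - (\<Sum>R\<in>P. measure M R *\<^sub>R f R)) \<le> L"
proof -
  interpret prob_space M by fact
  let ?F = "\<lambda>x. f (block P x) - (\<Sum>R\<in>P. prob R *\<^sub>R f R)"
  have "bochner_norm M (\<lambda>x. ?F x - translate \<Gamma> \<phi> s ?F x) \<le> L" if "s \<in> S" for s
  proof (rule bochner_norm_le_const[OF _ L])
    show "AE x in M. norm (?F x - translate \<Gamma> \<phi> s ?F x) \<le> L"
      using AE_translate_adjacent[OF prob act S P that]
    proof (rule eventually_mono)
      fix x
      assume "block P (\<phi> (inv\<^bsub>\<Gamma>\<^esub> s) x) = block P x \<or>
        (block P (\<phi> (inv\<^bsub>\<Gamma>\<^esub> s) x), block P x) \<in> approximating_graph S M \<phi> P"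
      then show "norm (?F x - translate \<Gamma> \<phi> s ?F x) \<le> L"
        using L lip by (auto simp: translate_def norm_minus_commute[of "f (block P x)"])
    qed
  qed
  \<comment> \<open>The inserted 0 is bounded by \<open>0 \<le> L\<close>, which also settles an
    empty \<open>S\<close>.\<close>
  then have "Max (insert 0 ((\<lambda>s. bochner_norm M (\<lambda>x. ?F x - translate \<Gamma> \<phi> s ?F x)) ` S)) \<le> L"
    using L S by (subst Max_le_iff) (auto simp: finite_symmetric_generating_set_def)
  then show ?thesis
    using gap centred_step_function_L2_0[OF P, of f] unfolding spectral_gap_def
    by (meson order_trans)
qed

section \<open>Concentration near the mean\<close>

text \<open>Markov's inequality for the squared norm gives the bound K^2 / (2K+1)^2. The summand 1
  keeps the threshold positive when \<open>K = 0\<close>.\<close>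

lemma (in prob_space) prob_large_norm_le_quarter:
  assumes F: "F \<in> bochner_L2 M" and [measurable]: "(\<lambda>x. norm (F x)) \<in> borel_measurable M"
    and K: "bochner_norm M F \<le> K"
  shows "prob {x \<in> space M. norm (F x) \<ge> 2 * K + 1} \<le> 1 / 4"
proof -
  have "0 \<le> bochner_norm M F"
    by (simp add: bochner_norm_def)
  with K have K0: "0 \<le> K" by simp
  have int: "integrable M (\<lambda>x. (norm (F x))\<^sup>2)"
    using F by (simp add: bochner_L2_def)
  have "expectation (\<lambda>x. (norm (F x))\<^sup>2) = (bochner_norm M F)\<^sup>2"
    by (simp add: bochner_norm_def)
  also have "\<dots> \<le> K\<^sup>2"
    using K \<open>0 \<le> bochner_norm M F\<close> by (rule power_mono)
  finally have E: "expectation (\<lambda>x. (norm (F x))\<^sup>2) \<le> K\<^sup>2" .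
  have "{x \<in> space M. norm (F x) \<ge> 2 * K + 1} \<subseteq> {x \<in> space M. (norm (F x))\<^sup>2 \<ge> (2 * K + 1)\<^sup>2}"
    using K0 by (auto intro: power_mono)
  then have "prob {x \<in> space M. norm (F x) \<ge> 2 * K + 1}
      \<le> prob {x \<in> space M. (norm (F x))\<^sup>2 \<ge> (2 * K + 1)\<^sup>2}"
    by (intro finite_measure_mono) auto
  also have "\<dots> \<le> expectation (\<lambda>x. (norm (F x))\<^sup>2) / (2 * K + 1)\<^sup>2"
    using int K0 by (intro integral_Markov_inequality_measure[where A="{}"]) auto
  also have "\<dots> \<le> K\<^sup>2 / (2 * K + 1)\<^sup>2"
    using E by (intro divide_right_mono) auto
  also have "\<dots> \<le> 1 / 4"
    using K0 by (simp add: divide_simps power2_eq_square) (simp add: algebra_simps)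
  finally show ?thesis .
qed

lemma (in prob_space) card_le_bounded_measure_ratios:
  assumes P: "finite_measurable_partition M P"
    and Q: "bounded_measure_ratios M P Q"
    and B: "B \<subseteq> P" "prob (\<Union>B) \<ge> 3 / 4"
  shows "3 * real (card P) \<le> 4 * Q * real (card B)"
proof -
  have part: "finite P" "P \<subseteq> sets M" "partition_on (space M) P"
    using P by (auto simp: finite_measurable_partition_def)
  have ratio: "prob R \<le> Q * prob R'" if "R \<in> P" "R' \<in> P" for R R'
    using Q that by (auto simp: bounded_measure_ratios_def divide_simps)
  \<comment> \<open>Comparing \<open>R\<close> with every region and summing shows that no region
    has more than \<open>Q\<close> times the average measure.\<close>
  have small: "real (card P) * prob R \<le> Q" if "R \<in> P" for R
  proof -
    have "real (card P) * prob R = (\<Sum>R'\<in>P. prob R)" by simp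
    also have "\<dots> \<le> (\<Sum>R'\<in>P. Q * prob R')"
      using ratio that by (intro sum_mono) auto
    also have "\<dots> = Q"
      using sum_prob_partition[OF P] by (simp flip: sum_distrib_left)
    finally show ?thesis .
  qed
  have "finite B" using B part finite_subset by blast
  have "3 / 4 * real (card P) \<le> real (card P) * prob (\<Union>B)"
    using mult_left_mono[OF B(2), of "real (card P)"] by simp
  also have "prob (\<Union>B) \<le> (\<Sum>R\<in>B. prob R)"
    using finite_measure_subadditive_finite[OF \<open>finite B\<close>, of "\<lambda>R. R"] B part by auto
  then have "real (card P) * prob (\<Union>B) \<le> real (card P) * (\<Sum>R\<in>B. prob R)"
    by (intro mult_left_mono) auto
  also have "\<dots> \<le> (\<Sum>R\<in>B. Q)"
    unfolding sum_distrib_left using small B by (intro sum_mono) auto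
  finally show ?thesis by (simp add: mult_ac)
qed

text \<open>The witness \<open>c\<close> is the mean of the step function. The radius comes from the
  norm bound \<open>L / \<epsilon>\<close> and depends on neither the space nor the partition, which
  makes the final count uniform over the sequence.\<close>

lemma spectral_gap_concentration:
  fixes f :: "'x set \<Rightarrow> 'e::banach"
  assumes prob: "prob_space M"
    and act: "measure_preserving_action \<Gamma> M \<phi>"
    and S: "finite_symmetric_generating_set \<Gamma> S"
    and P: "finite_measurable_partition M P"
    and Q: "bounded_measure_ratios M P Q"
    and gap: "spectral_gap TYPE('e) \<Gamma> S M \<phi> \<epsilon>" "\<epsilon> > 0"
    and lip: "\<And>R R'. (R, R') \<in> approximating_graph S M \<phi> P \<Longrightarrow> norm (f R - f R') \<le> L"
    and L: "0 \<le> L"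
  shows "\<exists>c. 3 * real (card P) \<le> 4 * Q * real (card {R \<in> P. norm (f R - c) < 2 * (L / \<epsilon>) + 1})"
proof -
  interpret prob_space M by fact
  define c where "c = (\<Sum>R\<in>P. prob R *\<^sub>R f R)"
  define B where "B = {R \<in> P. norm (f R - c) < 2 * (L / \<epsilon>) + 1}"
  let ?F = "\<lambda>x. f (block P x) - c"
  have part: "finite P" "P \<subseteq> sets M" "partition_on (space M) P"
    using P by (auto simp: finite_measurable_partition_def)
  have F: "?F \<in> bochner_L2 M"
    using centred_step_function_L2_0[OF P, of f] by (simp add: bochner_L2_0_def c_def)
  have meas[measurable]: "(\<lambda>x. norm (?F x)) \<in> borel_measurable M"
    using simple_function_compose1[OF simple_function_block[OF P], of "\<lambda>R. norm (f R - c)"]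
    by (rule borel_measurable_simple_function)
  have "bochner_norm M ?F \<le> L / \<epsilon>"
    using spectral_gap_step_function_norm[OF prob act S P gap(1) lip L] gap(2)
    by (simp add: c_def field_simps)
  then have "prob {x \<in> space M. norm (?F x) \<ge> 2 * (L / \<epsilon>) + 1} \<le> 1 / 4"
    by (rule prob_large_norm_le_quarter[OF F meas])
  \<comment> \<open>As \<open>?F\<close> is constant on each region, the set of points near the mean
    is a union of regions; its measure can therefore be turned into a number of vertices.\<close>
  moreover have "space M - {x \<in> space M. norm (?F x) \<ge> 2 * (L / \<epsilon>) + 1} = \<Union>B"
  proof -
    have "x \<in> \<Union>B \<longleftrightarrow> block P x \<in> B" if "x \<in> space M" for x
    proof
      assume "x \<in> \<Union>B"
      then obtain R where "R \<in> B" "x \<in> R" by blast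
      with block_eq[OF part(3), of R x] show "block P x \<in> B" by (simp add: B_def)
    qed (use block_in[OF part(3) that] in blast)
    then have "x \<in> \<Union>B \<longleftrightarrow> norm (?F x) < 2 * (L / \<epsilon>) + 1" if "x \<in> space M" for x
      using that block_in[OF part(3) that] by (simp add: B_def)
    moreover have "\<Union>B \<subseteq> space M"
      using part sets.sets_into_space by (auto simp: B_def)
    ultimately have "\<Union>B = {x \<in> space M. norm (?F x) < 2 * (L / \<epsilon>) + 1}"
      by blast
    then show ?thesis
      by (auto simp only: not_le[symmetric])
  qed
  moreover have "{x \<in> space M. norm (?F x) \<ge> 2 * (L / \<epsilon>) + 1} \<in> events"
    by measurable
  ultimately have "prob (\<Union>B) \<ge> 3 / 4"
    using prob_compl[of "{x \<in> space M. norm (?F x) \<ge> 2 * (L / \<epsilon>) + 1}"] by simp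
  then have "3 * real (card P) \<le> 4 * Q * real (card B)"
    by (intro card_le_bounded_measure_ratios[OF P Q]) (auto simp: B_def)
  then show ?thesis
    unfolding B_def by blast
qed

section \<open>Vertex counts in graphs of bounded degree\<close>

text \<open>Each further step of a walk multiplies the number of possible endpoints by at most
  \<open>d\<close>. Finiteness is carried through the same induction because
  \<open>card_UN_le\<close> needs a finite index set.\<close>

lemma finite_card_relpow_Image_le:
  fixes E :: "('v \<times> 'v) set"
  assumes "\<And>v. finite (E `` {v})" "\<And>v. card (E `` {v}) \<le> d"
  shows "finite ((E ^^ k) `` {v}) \<and> card ((E ^^ k) `` {v}) \<le> d ^ k"
proof (induction k)
  case (Suc k)
  let ?A = "(E ^^ k) `` {v}"
  have eq: "(E ^^ Suc k) `` {v} = (\<Union>w\<in>?A. E `` {w})"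
    by auto
  have "card (\<Union>w\<in>?A. E `` {w}) \<le> (\<Sum>w\<in>?A. card (E `` {w}))"
    using Suc.IH by (intro card_UN_le) auto
  also have "\<dots> \<le> card ?A * d"
    using assms(2) by (intro sum_bounded_above[where 'a=nat, simplified]) auto
  also have "\<dots> \<le> d ^ Suc k"
    using Suc.IH by simp
  finally show ?case
    unfolding eq using Suc.IH assms(1) by blast
qed auto

text \<open>The ball is covered by the endpoints of walks of length at most \<open>m\<close>.
  Reachability is demanded separately because \<open>graph_dist\<close> assigns 0 to unreachable
  pairs.\<close>

lemma card_le_graph_ball:
  assumes fin: "\<And>v. finite (E `` {v})" and deg: "\<And>v. card (E `` {v}) \<le> d"
    and B: "\<And>w. w \<in> B \<Longrightarrow> (v, w) \<in> E\<^sup>* \<and> graph_dist E v w \<le> real m"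
  shows "card B \<le> (\<Sum>k\<le>m. d ^ k)"
proof -
  have "B \<subseteq> (\<Union>k\<le>m. (E ^^ k) `` {v})"
  proof
    fix w assume "w \<in> B"
    then have "(v, w) \<in> E\<^sup>*" "(LEAST k. (v, w) \<in> E ^^ k) \<le> m"
      using B[of w] by (auto simp: graph_dist_def)
    moreover from this(1) have "(v, w) \<in> E ^^ (LEAST k. (v, w) \<in> E ^^ k)"
      by (metis LeastI rtrancl_imp_relpow)
    ultimately show "w \<in> (\<Union>k\<le>m. (E ^^ k) `` {v})" by auto
  qed
  then have "card B \<le> card (\<Union>k\<le>m. (E ^^ k) `` {v})"
    using finite_card_relpow_Image_le[OF fin deg] by (intro card_mono) auto
  also have "\<dots> \<le> (\<Sum>k\<le>m. card ((E ^^ k) `` {v}))"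
    by (rule card_UN_le) auto
  also have "\<dots> \<le> (\<Sum>k\<le>m. d ^ k)"
    using finite_card_relpow_Image_le[OF fin deg] by (intro sum_mono) auto
  finally show ?thesis .
qed

lemma card_Image_le_graph_degree:
  assumes "finite V" "E \<subseteq> V \<times> V"
  shows "card (E `` {v}) \<le> graph_degree V E"
proof (cases "v \<in> V")
  case True
  then show ?thesis
    unfolding graph_degree_def using assms(1) by (intro Max_ge) auto
next
  case False
  then have "E `` {v} = {}" using assms(2) by auto
  then show ?thesis by simp
qed

lemma graph_dist_edge_le: "(u, v) \<in> E \<Longrightarrow> graph_dist E u v \<le> 1"
  using Least_le[of "\<lambda>k. (u, v) \<in> E ^^ k" 1] by (auto simp: graph_dist_def)

text \<open>The hypothesis \<open>unbounded\<close> excludes trivial cases: for one-point spaces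
  with a single region the other hypotheses can all hold, yet constant maps embed the graphs. The
  proof bounds \<open>card (\<P> n)\<close> uniformly in \<open>n\<close>.\<close>

theorem proposition3p3:
  fixes D Q \<epsilon> :: real
    and \<Gamma> :: "nat \<Rightarrow> 'g monoid"
    and S :: "nat \<Rightarrow> 'g set"
    and X :: "nat \<Rightarrow> 'x measure"
    and \<phi> :: "nat \<Rightarrow> 'g \<Rightarrow> 'x \<Rightarrow> 'x"
    and \<P> :: "nat \<Rightarrow> 'x set set"
  assumes "D \<ge> 1" and "Q \<ge> 1"
    and "\<And>n. group (\<Gamma> n)"
    and "\<And>n. finite_symmetric_generating_set (\<Gamma> n) (S n)"
    and "\<And>n. prob_space (X n)"
    and "\<And>n. measure_preserving_action (\<Gamma> n) (X n) (\<phi> n)"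
    and "\<And>n. finite_measurable_partition (X n) (\<P> n)"
    and unbounded: "\<not> bdd_above (range (\<lambda>n. card (\<P> n)))"
    and "\<And>n. bounded_measure_ratios (X n) (\<P> n) Q"
    and "\<And>n. real (graph_degree (\<P> n) (approximating_graph (S n) (X n) (\<phi> n) (\<P> n))) \<le> D"
    and "\<epsilon> > 0"
    and "\<And>n. spectral_gap TYPE('e::banach) (\<Gamma> n) (S n) (X n) (\<phi> n) \<epsilon>"
  shows "\<not> coarsely_embed_uniformly TYPE('e) \<P>
            (\<lambda>n. graph_dist (approximating_graph (S n) (X n) (\<phi> n) (\<P> n)))"
proof
  define G where "G n = approximating_graph (S n) (X n) (\<phi> n) (\<P> n)" for n
  assume "coarsely_embed_uniformly TYPE('e) \<P>
            (\<lambda>n. graph_dist (approximating_graph (S n) (X n) (\<phi> n) (\<P> n)))"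
  then obtain \<rho>\<^sub>1 \<rho>\<^sub>2 :: "real \<Rightarrow> real" and f :: "nat \<Rightarrow> 'x set \<Rightarrow> 'e"
    where metric: "\<forall>n. Metric_space (\<P> n) (graph_dist (G n))"
      and \<rho>\<^sub>1: "mono_on {0..} \<rho>\<^sub>1" "\<not> bdd_above (\<rho>\<^sub>1 ` {0..})"
      and \<rho>\<^sub>2: "\<rho>\<^sub>2 \<in> {0..} \<rightarrow> {0..}" "mono_on {0..} \<rho>\<^sub>2"
      and f: "\<forall>n. \<forall>R\<in>\<P> n. \<forall>R'\<in>\<P> n.
           \<rho>\<^sub>1 (graph_dist (G n) R R') \<le> norm (f n R - f n R') \<and>
           norm (f n R - f n R') \<le> \<rho>\<^sub>2 (graph_dist (G n) R R')"
    unfolding coarsely_embed_uniformly_def G_def[symmetric] by (elim conjE exE) (rule that)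
  \<comment> \<open>This is the concentration radius for \<open>L = \<rho>\<^sub>2 1\<close>, the
    bound on how far apart the embedding puts adjacent vertices.\<close>
  define r where "r = 2 * (\<rho>\<^sub>2 1 / \<epsilon>) + 1"
  \<comment> \<open>Two points in a ball of radius \<open>r\<close> are less than
    \<open>2 * r\<close> apart, so this choice forces their vertices to be at graph distance below
    \<open>t\<close>.\<close>
  obtain t where t: "t \<ge> 0" "\<rho>\<^sub>1 t > 2 * r"
    using \<rho>\<^sub>1(2) by (force simp: bdd_above_def not_le)
  define m where "m = nat \<lceil>t\<rceil>"
  define d where "d = nat \<lfloor>D\<rfloor>"
  define N where "N = (\<Sum>k\<le>m. d ^ k)"
  have "card (\<P> n) \<le> nat \<lfloor>4 * Q * real N / 3\<rfloor>" for n
  proof -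
    have fin: "finite (\<P> n)" and sub: "\<P> n \<subseteq> sets (X n)"
      using assms(7)[of n] by (auto simp: finite_measurable_partition_def)
    have G: "G n \<subseteq> \<P> n \<times> \<P> n"
      by (auto simp: G_def approximating_graph_def)
    \<comment> \<open>The metric axioms contained in the assumed embedding amount to connectedness,
      since the graph is symmetric.\<close>
    have conn: "\<P> n \<times> \<P> n \<subseteq> (G n)\<^sup>*"
      using spec[OF metric, of n] sym_approximating_graph[OF assms(6,4) sub]
      by (simp add: Metric_space_graph_dist G_def)
    have dist0: "0 \<le> graph_dist (G n) R R'" for R R'
      by (simp add: graph_dist_def)
    have deg: "card (G n `` {R}) \<le> d" for R
    proof -
      have "real (card (G n `` {R})) \<le> D"
        using card_Image_le_graph_degree[OF fin G, of R] assms(10)[of n] by (simp add: G_def)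
      then show ?thesis unfolding d_def by (simp add: le_nat_floor)
    qed
    have finG: "finite (G n `` {R})" for R
      using finite_subset[of "G n `` {R}" "\<P> n"] G fin by auto
    have lip: "norm (f n R - f n R') \<le> \<rho>\<^sub>2 1" if "(R, R') \<in> G n" for R R'
    proof -
      have "norm (f n R - f n R') \<le> \<rho>\<^sub>2 (graph_dist (G n) R R')"
        using that G f by auto
      also have "\<dots> \<le> \<rho>\<^sub>2 1"
        using \<rho>\<^sub>2(2) graph_dist_edge_le[OF that] dist0 by (auto elim: mono_onD)
      finally show ?thesis .
    qed
    have "0 \<le> \<rho>\<^sub>2 1" using \<rho>\<^sub>2(1) by auto
    then have "\<exists>c. 3 * real (card (\<P> n)) \<le> 4 * Q * real (card {R \<in> \<P> n. norm (f n R - c) < r})"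
      unfolding r_def
      using lip[unfolded G_def]
      by (intro spectral_gap_concentration[OF assms(5,6,4,7,9,12,11)])
    then obtain c where
      c: "3 * real (card (\<P> n)) \<le> 4 * Q * real (card {R \<in> \<P> n. norm (f n R - c) < r})"
      by blast
    define B where "B = {R \<in> \<P> n. norm (f n R - c) < r}"
    have "card B \<le> N"
    \<comment> \<open>A nonempty \<open>B\<close> supplies its own centre: the ball is taken around
      one of its vertices, as \<open>c\<close> need not be the image of a vertex.\<close>
    proof (cases "B = {}")
      case False
      then obtain R where R: "R \<in> B" by blast
      have "(R, R') \<in> (G n)\<^sup>* \<and> graph_dist (G n) R R' \<le> real m" if R': "R' \<in> B" for R'
      proof
        show "(R, R') \<in> (G n)\<^sup>*" using conn R R' by (auto simp: B_def)
        have "norm (f n R - f n R') \<le> norm (f n R - c) + norm (f n R' - c)"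
          by (metis norm_triangle_ineq4 diff_diff_eq2 diff_add_cancel)
        then have "norm (f n R - f n R') < \<rho>\<^sub>1 t"
          using R R' t(2) by (auto simp: B_def)
        moreover have "\<rho>\<^sub>1 (graph_dist (G n) R R') \<le> norm (f n R - f n R')"
          using f R R' by (auto simp: B_def)
        ultimately have "\<not> t \<le> graph_dist (G n) R R'"
          using mono_onD[OF \<rho>\<^sub>1(1), of t "graph_dist (G n) R R'"] t(1) dist0 by force
        then show "graph_dist (G n) R R' \<le> real m"
          unfolding m_def by linarith
      qed
      then show ?thesis
        unfolding N_def by (intro card_le_graph_ball[OF finG deg])
    qed simp
    then have "4 * Q * real (card B) \<le> 4 * Q * real N"
      using assms(2) by (intro mult_left_mono) auto
    with c have "real (card (\<P> n)) \<le> 4 * Q * real N / 3"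
      by (simp add: B_def)
    then show ?thesis by (rule le_nat_floor)
  qed
  then have "bdd_above (range (\<lambda>n. card (\<P> n)))"
    by (intro bdd_aboveI) auto
  with unbounded show False by contradiction
qed

end
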